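(* Let $C=\{x\in\mathbb{R}^n:x>0\}$, $\mathcal{M}=\{x\in\mathbb{R}^n:Ax=b\}$, and let $\phi$ be a separable kernel as described in the context. Suppose a trajectory $x(t)$, $t\ge0$, of $$\dot x(t)\in-\mathrm{P}_{x(t)}\nabla^2\phi(x(t))^{-1}\partial f(x(t))\ \text{ for a.e. }t>0,\qquad x(0)\in\mathcal{M}\cap C,$$ converges to a point $x^*$ as $t\to\infty$. Then $x^*\in\Omega$.
   Context: $f:\mathbb{R}^n\to\mathbb{R}$ is locally Lipschitz and path-differentiable: for every absolutely continuous curve $z:[0,\infty)\to\mathbb{R}^n$, $f\circ z$ is absolutely continuous and $\frac{d}{dt}f(z(t))=\langle v,\dot z(t)\rangle$ for all $v\in\partial f(z(t))$ and a.e. $t$; $\partial f$ is the Clarke subdifferential. $A\in\mathbb{R}^{m\times n}$ has full row rank. Kernel: $\phi(x)=\sum_{i=1}^n\phi_i(x_i)$, where each $\phi_i$ is differentiable and strictly convex on $(0,\infty)$ with $|\phi_i'(t)|\to\infty$ as $t\to0^+$, and there exist $\gamma>0$ and continuous $\psi_i:\mathbb{R}\to(0,\infty)$ with $\phi_i''(t)=t^{-\gamma}\psi_i(t)$ for $t>0$. Put $H(x)=\nabla^2\phi(x)$. For $x\in\mathcal{M}\cap C$, $\mathrm{P}_x=I-H(x)^{-1}A^T(AH(x)^{-1}A^T)^{-1}A$ is the projection onto $\{z:Az=0\}$ in the metric $u^TH(x)v$; it is a standing assumption that $\mathrm{P}_xH(x)^{-1}$ extends continuously to $\mathcal{M}\cap\overline{C}$.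 Trajectories are absolutely continuous and stay in $\mathcal{M}\cap C$ for all $t\ge0$. Stationary set: $\Omega=\{x\in\mathcal{M}\cap\overline{C}:0\in\partial f(x)+\mathrm{range}(A^T)+N_{\overline{C}}(x)\}$, with $N_{\overline{C}}$ the normal cone of convex analysis. *)

theory Defs
  imports "HOL-Analysis.Analysis" "HOL-Library.Set_Algebras"
begin

text \<open>Absolute continuity (epsilon-delta) on a set of reals. The finite family of non-overlapping
  compact intervals is a division \<open>D\<close> of its own union.\<close>

definition abs_continuous_on :: "real set \<Rightarrow> (real \<Rightarrow> 'a::real_normed_vector) \<Rightarrow> bool"
  where "abs_continuous_on S g \<longleftrightarrow>
    (\<forall>\<epsilon>>0. \<exists>\<delta>>0. \<forall>D. D division_of \<Union>D \<and> \<Union>D \<subseteq> S \<and> (\<Sum>K\<in>D. Sup K - Inf K) < \<delta> \<longrightarrow>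
      (\<Sum>K\<in>D. norm (g (Sup K) - g (Inf K))) < \<epsilon>)"

text \<open>For a curve on the unbounded interval \<open>[0,\<infinity>)\<close>, absolute continuity means
  absolute continuity on every compact subinterval. Values at negative times play no role.\<close>

definition abs_continuous_curve :: "(real \<Rightarrow> 'a::real_normed_vector) \<Rightarrow> bool"
  where "abs_continuous_curve z \<longleftrightarrow> (\<forall>T\<ge>0. abs_continuous_on {0..T} z)"

definition locally_lipschitz :: "('a::metric_space \<Rightarrow> 'b::metric_space) \<Rightarrow> bool"
  where "locally_lipschitz f \<longleftrightarrow> (\<forall>x. \<exists>u>0. \<exists>L. L-lipschitz_on (cball x u) f)"

text \<open>Clarke's generalized directional derivative, the upper limit of
  \<open>(f (y + t d) - f y) / t\<close> as \<open>y \<rightarrow> x\<close> and \<open>t \<down> 0\<close>; it is finite for locally Lipschitz \<open>f\<close>.\<close>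

definition clarke_dirderiv :: "('a::real_normed_vector \<Rightarrow> real) \<Rightarrow> 'a \<Rightarrow> 'a \<Rightarrow> ereal"
  where "clarke_dirderiv f x d =
    Limsup (nhds x \<times>\<^sub>F at_right 0) (\<lambda>(y, t). ereal ((f (y + t *\<^sub>R d) - f y) / t))"

definition clarke_subdiff :: "('a::real_inner \<Rightarrow> real) \<Rightarrow> 'a \<Rightarrow> 'a set"
  where "clarke_subdiff f x = {v. \<forall>d. ereal (v \<bullet> d) \<le> clarke_dirderiv f x d}"

definition path_differentiable :: "('a::real_inner \<Rightarrow> real) \<Rightarrow> bool"
  where "path_differentiable f \<longleftrightarrow>
    (\<forall>z. abs_continuous_curve z \<longrightarrow>
      abs_continuous_curve (f \<circ> z) \<and>
      (AE t in lborel. t > 0 \<longrightarrow>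
        (\<exists>z'. (z has_vector_derivative z') (at t) \<and>
          (\<forall>v\<in>clarke_subdiff f (z t). ((f \<circ> z) has_real_derivative v \<bullet> z') (at t)))))"

definition normal_cone :: "'a::real_inner set \<Rightarrow> 'a \<Rightarrow> 'a set"
  where "normal_cone S x = (if x \<in> S then {v. \<forall>y\<in>S. v \<bullet> (y - x) \<le> 0} else {})"

definition pos_orthant :: "(real ^ 'n) set"
  where "pos_orthant = {x. \<forall>i. 0 < x $ i}"

definition affine_constraint :: "real ^ 'n ^ 'm \<Rightarrow> real ^ 'm \<Rightarrow> (real ^ 'n) set"
  where "affine_constraint A b = {x. A *v x = b}"

definition strictly_convex_on :: "'a::real_vector set \<Rightarrow> ('a \<Rightarrow> real) \<Rightarrow> bool"
  where "strictly_convex_on S g \<longleftrightarrow> convex S \<and>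
    (\<forall>x\<in>S. \<forall>y\<in>S. \<forall>u>0. \<forall>v>0. x \<noteq> y \<and> u + v = 1 \<longrightarrow>
      g (u *\<^sub>R x + v *\<^sub>R y) < u * g x + v * g y)"

text \<open>The values of a kernel outside the open positive orthant are left unspecified.\<close>

definition separable_kernel :: "(real ^ 'n \<Rightarrow> real) \<Rightarrow> bool"
  where "separable_kernel \<phi> \<longleftrightarrow>
    (\<exists>(\<phi>\<^sub>c :: 'n \<Rightarrow> real \<Rightarrow> real) (\<gamma> :: real) (\<psi> :: 'n \<Rightarrow> real \<Rightarrow> real).
      (\<forall>x\<in>pos_orthant. \<phi> x = (\<Sum>i\<in>UNIV. \<phi>\<^sub>c i (x $ i))) \<and>
      \<gamma> > 0 \<and>
      (\<forall>i. \<phi>\<^sub>c i differentiable_on {0<..} \<and>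
           strictly_convex_on {0<..} (\<phi>\<^sub>c i) \<and>
           filterlim (\<lambda>t. \<bar>deriv (\<phi>\<^sub>c i) t\<bar>) at_top (at_right 0) \<and>
           continuous_on UNIV (\<psi> i) \<and> (\<forall>t. \<psi> i t > 0) \<and>
           (\<forall>t>0. (deriv (\<phi>\<^sub>c i) has_real_derivative t powr (- \<gamma>) * \<psi> i t) (at t))))"

definition partial_deriv :: "'n \<Rightarrow> (real ^ 'n \<Rightarrow> real) \<Rightarrow> real ^ 'n \<Rightarrow> real"
  where "partial_deriv i g x = deriv (\<lambda>t. g (x + t *\<^sub>R axis i 1)) 0"

definition hessian :: "(real ^ 'n \<Rightarrow> real) \<Rightarrow> real ^ 'n \<Rightarrow> real ^ 'n ^ 'n"
  where "hessian g x = (\<chi> i j. partial_deriv i (partial_deriv j g) x)"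

text \<open>\<open>P\<^sub>x = I - H\<inverse> A\<^sup>T (A H\<inverse> A\<^sup>T)\<inverse> A\<close> with \<open>H = \<nabla>\<^sup>2\<phi>(x)\<close>; meaningful only for \<open>x\<close> in the open
  positive orthant and \<open>A\<close> of full row rank, where both inverses exist.\<close>

definition hess_proj :: "real ^ 'n ^ 'm \<Rightarrow> (real ^ 'n \<Rightarrow> real) \<Rightarrow> real ^ 'n \<Rightarrow> real ^ 'n ^ 'n"
  where "hess_proj A \<phi> x =
    mat 1 - matrix_inv (hessian \<phi> x) ** transpose A **
      matrix_inv (A ** matrix_inv (hessian \<phi> x) ** transpose A) ** A"

text \<open>Absolutely continuous solutions of \<open>x'(t) \<in> - P\<^bsub>x(t)\<^esub> (\<nabla>\<^sup>2\<phi>(x(t)))\<inverse> \<partial>f(x(t))\<close>, a.e. \<open>t > 0\<close>,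
  that start in and never leave the relative interior of the feasible set.\<close>

definition trajectory ::
    "real ^ 'n ^ 'm \<Rightarrow> real ^ 'm \<Rightarrow> (real ^ 'n \<Rightarrow> real) \<Rightarrow> (real ^ 'n \<Rightarrow> real) \<Rightarrow> (real \<Rightarrow> real ^ 'n) \<Rightarrow> bool"
  where "trajectory A b \<phi> f x \<longleftrightarrow>
    abs_continuous_curve x \<and>
    x 0 \<in> affine_constraint A b \<inter> pos_orthant \<and>
    (\<forall>t\<ge>0. x t \<in> affine_constraint A b \<inter> pos_orthant) \<and>
    (AE t in lborel. t > 0 \<longrightarrow>
      (\<exists>v\<in>clarke_subdiff f (x t).
        (x has_vector_derivative
          - (hess_proj A \<phi> (x t) *v (matrix_inv (hessian \<phi> (x t)) *v v))) (at t)))"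

definition stationary_set :: "real ^ 'n ^ 'm \<Rightarrow> real ^ 'm \<Rightarrow> (real ^ 'n \<Rightarrow> real) \<Rightarrow> (real ^ 'n) set"
  where "stationary_set A b f =
    {x \<in> affine_constraint A b \<inter> closure pos_orthant.
      0 \<in> clarke_subdiff f x + range (\<lambda>y. transpose A *v y) + normal_cone (closure pos_orthant) x}"

end

theory Submission
  imports Defs
begin

text \<open>
  The proof passes to the mirror variable \<open>\<nabla>\<phi>(x(t))\<close>. Along the flow its derivative is
  \<open>- v(t) + A\<^sup>T y(t)\<close> with \<open>v(t) \<in> \<partial>f(x(t))\<close>, so that
  \<open>d/dt \<langle>\<nabla>\<phi>(x(t)), d\<rangle> = - \<langle>v(t), d\<rangle>\<close> for every \<open>d\<close> with \<open>A d = 0\<close>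
  (\<open>has_derivative_kernel_pairing\<close>).

  Suppose that the limit \<open>x\<^sup>*\<close> is not stationary. Then the compact convex set \<open>- \<partial>f(x\<^sup>*)\<close> misses the
  polyhedral cone \<open>range A\<^sup>T + N(x\<^sup>*)\<close>, and strict separation yields a feasible direction \<open>d\<close>, that
  is \<open>A d = 0\<close> and \<open>d\<^sub>i \<ge> 0\<close> whenever \<open>x\<^sup>*\<^sub>i = 0\<close>, with a number \<open>c > 0\<close> such that
  \<open>\<langle>v, d\<rangle> < - c\<close> for all \<open>v \<in> \<partial>f(x\<^sup>*)\<close> (\<open>separating_feasible_direction\<close>). By upper semicontinuity of the Clarke
  subdifferential the same bound holds at \<open>x(t)\<close> for all large \<open>t\<close>
  (\<open>clarke_subdiff_upper_semicontinuous\<close>). Hence \<open>\<langle>\<nabla>\<phi>(x(t)), d\<rangle>\<close> has derivative at least \<open>c\<close> almost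
  everywhere, and being absolutely continuous it tends to infinity
  (\<open>abs_continuous_on_increment_ge\<close>).

  On the other hand this quantity is bounded above: coordinates with \<open>x\<^sup>*\<^sub>i > 0\<close> contribute convergent
  terms, and for \<open>x\<^sup>*\<^sub>i = 0\<close> the increasing function \<open>\<phi>\<^sub>i'\<close> is bounded above near zero while
  \<open>d\<^sub>i \<ge> 0\<close> (\<open>eventually_kernel_pairing_bounded\<close>).
\<close>


section \<open>Absolutely continuous functions\<close>

text \<open>Converts the lengths in the definition of absolute continuity into Lebesgue measure, so that they can be
  bounded by the measure of an open cover.\<close>

lemma sum_division_length:
  fixes D :: "real set set"
  assumes D: "D division_of S"
  shows "(\<Sum>K\<in>D. Sup K - Inf K) = measure lebesgue S"
proof -
  have len: "Sup K - Inf K = integral K (\<lambda>_. 1::real)" if K: "K \<in> D" for K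
  proof -
    obtain u v where uv: "K = {u..v}"
      using division_ofD(4)[OF D K] by auto
    moreover have "K \<noteq> {}"
      using division_ofD(3)[OF D K] .
    ultimately show ?thesis by auto
  qed
  have "((\<lambda>_. 1::real) has_integral (\<Sum>K\<in>D. integral K (\<lambda>_. 1))) S"
  proof (rule has_integral_combine_division[OF D])
    fix K assume "K \<in> D"
    then obtain u v where "K = {u..v}"
      using division_ofD(4)[OF D] by (metis box_real(2))
    then show "((\<lambda>_. 1::real) has_integral integral K (\<lambda>_. 1)) K"
      using integrable_integral[OF integrable_const_ivl] by blast
  qed
  moreover have "S \<in> lmeasurable"
    using D by (rule lmeasurable_division)
  ultimately have "measure lebesgue S = (\<Sum>K\<in>D. integral K (\<lambda>_. 1))"
    by (simp add: lmeasure_integral integral_unique)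
  then show ?thesis
    by (simp add: len)
qed

text \<open>A one-sided fundamental theorem of calculus for absolutely continuous functions. The exceptional null
  set is covered by an open set of small measure. By Cousin's lemma there is a tagged division fine for a
  suitable gauge: the intervals with a tag in the null set lie in the cover, so absolute continuity makes
  their total increment negligible, and on each other interval the increment is at least \<open>c - e\<close> times
  its length.\<close>

lemma abs_continuous_on_increment_ge:
  fixes g :: "real \<Rightarrow> real"
  assumes "a \<le> b"
    and ac: "abs_continuous_on {a..b} g"
    and null: "N \<in> null_sets lebesgue"
    and deriv: "\<And>t. t \<in> {a..b} - N \<Longrightarrow>
      \<exists>D\<ge>c. (g has_real_derivative D) (at t within {a..b})"
  shows "c * (b - a) \<le> g b - g a"
proof -
  have main: "c * (b - a) \<le> g b - g a + e * (2 + (b - a))" if "e > 0" for e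
  proof -
    obtain \<delta> where "\<delta> > 0" and \<delta>: "\<And>D. D division_of \<Union>D \<Longrightarrow> \<Union>D \<subseteq> {a..b} \<Longrightarrow>
        (\<Sum>K\<in>D. Sup K - Inf K) < \<delta> \<Longrightarrow> (\<Sum>K\<in>D. norm (g (Sup K) - g (Inf K))) < e"
      using ac[unfolded abs_continuous_on_def, rule_format, OF \<open>e > 0\<close>] by blast
    \<comment> \<open>The intervals tagged in the null set will have a total length \<open>l\<close> below \<open>\<delta>'\<close>; the second bound
        keeps the increment \<open>(c - e) * l\<close> missing there below \<open>e\<close>.\<close>
    define \<delta>' where "\<delta>' = min \<delta> (e / (1 + \<bar>c - e\<bar>))"
    have "\<delta>' > 0" "\<delta>' \<le> \<delta>"
      using \<open>\<delta> > 0\<close> \<open>e > 0\<close> by (auto simp: \<delta>'_def)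
    have small: "(c - e) * l \<le> e" if "0 \<le> l" "l < \<delta>'" for l
    proof -
      have "(c - e) * l \<le> (1 + \<bar>c - e\<bar>) * l"
        using that by (intro mult_right_mono) auto
      also have "\<dots> \<le> (1 + \<bar>c - e\<bar>) * (e / (1 + \<bar>c - e\<bar>))"
        using that by (intro mult_left_mono) (auto simp: \<delta>'_def)
      also have "\<dots> = e"
        by (simp add: add_nonneg_eq_0_iff)
      finally show ?thesis .
    qed
    obtain U where "open U" "N \<subseteq> U" and U: "U - N \<in> lmeasurable"
        "emeasure lebesgue (U - N) < ennreal \<delta>'"
      using sets_lebesgue_outer_open[of N \<delta>'] null \<open>\<delta>' > 0\<close> by (auto simp: null_sets_def)
    have Umeas: "U \<in> sets lebesgue"
      using \<open>open U\<close> by auto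
    have emU: "emeasure lebesgue U < ennreal \<delta>'"
      using U(2) emeasure_Diff_null_set[OF null Umeas] by simp
    then have "U \<in> lmeasurable"
      using Umeas by (auto simp: fmeasurable_def intro: less_trans[of _ "ennreal \<delta>'"])
    have muU: "measure lebesgue U < \<delta>'"
      using emU \<open>\<delta>' > 0\<close> \<open>U \<in> lmeasurable\<close>
      by (simp add: emeasure_eq_measure2 ennreal_less_iff)
    \<comment> \<open>The gauge keeps an interval inside \<open>U\<close> when its tag is exceptional, and makes the difference
        quotients on both sides of the tag at least \<open>c - e\<close> otherwise.\<close>
    have "\<exists>r>0. (t \<in> N \<longrightarrow> ball t r \<subseteq> U) \<and>
        (t \<in> {a..b} - N \<longrightarrow> (\<forall>y\<in>{a..b}. \<bar>y - t\<bar> < r \<longrightarrow>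
          (t \<le> y \<longrightarrow> (c - e) * (y - t) \<le> g y - g t) \<and>
          (y \<le> t \<longrightarrow> (c - e) * (t - y) \<le> g t - g y)))" for t
    proof (cases "t \<in> N")
      case True
      then have "t \<in> U" using \<open>N \<subseteq> U\<close> by auto
      then show ?thesis
        using \<open>open U\<close> True unfolding open_contains_ball by blast
    next
      case out: False
      show ?thesis
      proof (cases "t \<in> {a..b}")
        case True
        then obtain D where "c \<le> D" and D: "(g has_real_derivative D) (at t within {a..b})"
          using deriv[of t] out by blast
        then obtain r where "r > 0" and r: "\<And>y. y \<in> {a..b} \<Longrightarrow> norm (y - t) < r \<Longrightarrow>
            norm (g y - g t - D * (y - t)) \<le> e * norm (y - t)"
          using \<open>e > 0\<close> unfolding has_field_derivative_def has_derivative_within_alt by blast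
        have "(t \<le> y \<longrightarrow> (c - e) * (y - t) \<le> g y - g t) \<and>
            (y \<le> t \<longrightarrow> (c - e) * (t - y) \<le> g t - g y)" if y: "y \<in> {a..b}" "\<bar>y - t\<bar> < r" for y
        proof -
          have *: "\<bar>g y - g t - D * (y - t)\<bar> \<le> e * \<bar>y - t\<bar>"
            using r y by simp
          have mono: "c * \<bar>y - t\<bar> \<le> D * \<bar>y - t\<bar>"
            using \<open>c \<le> D\<close> by (intro mult_right_mono) auto
          show ?thesis
          proof (cases "t \<le> y")
            case True
            then show ?thesis using * mono by (auto simp: algebra_simps abs_le_iff)
          next
            case False
            then show ?thesis using * mono by (auto simp: algebra_simps abs_le_iff)
          qed
        qed
        then show ?thesis
          using \<open>r > 0\<close> out by blast
      qed (use out in \<open>auto intro: exI[of _ 1]\<close>)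
    qed
    then obtain r where r0: "\<And>t. r t > 0"
      and rN: "\<And>t. t \<in> N \<Longrightarrow> ball t (r t) \<subseteq> U"
      and rD: "\<And>t y. t \<in> {a..b} - N \<Longrightarrow> y \<in> {a..b} \<Longrightarrow> \<bar>y - t\<bar> < r t \<Longrightarrow>
          (t \<le> y \<longrightarrow> (c - e) * (y - t) \<le> g y - g t) \<and>
          (y \<le> t \<longrightarrow> (c - e) * (t - y) \<le> g t - g y)"
      by metis
    have "gauge (\<lambda>t. ball t (r t))"
      using r0 by (auto simp: gauge_def)
    then obtain p where p: "p tagged_division_of {a..b}" and fine: "(\<lambda>t. ball t (r t)) fine p"
      by (rule fine_division_exists_real)
    have piece: "\<exists>u v. K = {u..v} \<and> Inf K = u \<and> Sup K = v \<and> u \<le> t \<and> t \<le> v \<and> t \<in> {a..b} \<and>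
        u \<in> {a..b} \<and> v \<in> {a..b} \<and> \<bar>u - t\<bar> < r t \<and> \<bar>v - t\<bar> < r t" if tK: "(t, K) \<in> p" for t K
    proof -
      obtain u v where "K = {u..v}" "t \<in> K" "K \<subseteq> {a..b}"
        using tagged_division_ofD(2-4)[OF p tK] by (metis box_real(2))
      moreover have "K \<subseteq> ball t (r t)"
        using fine tK by (auto simp: fine_def)
      moreover have "u \<in> K" "v \<in> K" "u \<le> v" "u \<le> t" "t \<le> v"
        using calculation by auto
      moreover have "Inf K = u" "Sup K = v"
        using calculation by simp_all
      moreover have "u \<in> ball t (r t)" "v \<in> ball t (r t)" "t \<in> {a..b}" "u \<in> {a..b}" "v \<in> {a..b}"
        using calculation by blast+
      ultimately show ?thesis
        by (intro exI[of _ u] exI[of _ v]) (simp add: dist_real_def abs_minus_commute)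
    qed
    have fin: "finite p"
      using p by (rule tagged_division_of_finite)
    define p1 where "p1 = {(t, K) \<in> p. t \<in> N}"
    have "p1 \<subseteq> p"
      by (auto simp: p1_def)
    have p1: "p1 tagged_partial_division_of {a..b}"
      using p \<open>p1 \<subseteq> p\<close> by (meson tagged_division_of_def tagged_partial_division_subset)
    have div1: "snd ` p1 division_of \<Union>(snd ` p1)"
      using p1 by (rule partial_division_of_tagged_division)
    have transfer: "(\<Sum>(t, K)\<in>p1. h (Sup K) - h (Inf K)) = (\<Sum>K\<in>snd ` p1. h (Sup K) - h (Inf K))"
      for h :: "real \<Rightarrow> real"
    proof -
      have nonempty: "K \<noteq> {}" if "(t, K) \<in> p1" for t K
        using tagged_partial_division_ofD(2)[OF p1 that] by blast
      \<comment> \<open>The value at the empty set is set to 0 because \<open>Sup {}\<close> and \<open>Inf {}\<close> are unspecified.\<close>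
      let ?d = "\<lambda>K. if K = {} then 0 else h (Sup K) - h (Inf K)"
      have "(\<Sum>(t, K)\<in>p1. h (Sup K) - h (Inf K)) = (\<Sum>(t, K)\<in>p1. ?d K)"
        using nonempty by (intro sum.cong) auto
      also have "\<dots> = sum ?d (snd ` p1)"
      proof (rule sum.over_tagged_division_lemma[OF tagged_partial_division_of_Union_self[OF p1]])
        fix u v :: real
        assume "box u v = {}"
        then have "v \<le> u" by (simp add: not_less)
        then show "?d (cbox u v) = 0"
          by (cases "u = v") auto
      qed
      also have "\<dots> = (\<Sum>K\<in>snd ` p1. h (Sup K) - h (Inf K))"
        using nonempty by (intro sum.cong) auto
      finally show ?thesis .
    qed
    define l1 where "l1 = (\<Sum>(t, K)\<in>p1. Sup K - Inf K)"
    have l1_eq: "l1 = (\<Sum>K\<in>snd ` p1. Sup K - Inf K)"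
      unfolding l1_def using transfer[of "\<lambda>s. s"] by simp
    have "\<Union>(snd ` p1) \<subseteq> U"
      using rN fine by (fastforce simp: p1_def fine_def)
    then have "measure lebesgue (\<Union>(snd ` p1)) \<le> measure lebesgue U"
      using \<open>U \<in> lmeasurable\<close> lmeasurable_division[OF div1]
      by (intro measure_mono_fmeasurable) auto
    then have l1: "0 \<le> l1" "l1 < \<delta>'"
      using muU by (auto simp: l1_eq sum_division_length[OF div1])
    have "\<bar>\<Sum>(t, K)\<in>p1. g (Sup K) - g (Inf K)\<bar> \<le> (\<Sum>K\<in>snd ` p1. norm (g (Sup K) - g (Inf K)))"
      by (simp add: transfer sum_abs)
    also have "\<dots> < e"
    proof (rule \<delta>[OF div1])
      show "\<Union>(snd ` p1) \<subseteq> {a..b}"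
        using tagged_partial_division_ofD(3)[OF p1] by fastforce
      show "(\<Sum>K\<in>snd ` p1. Sup K - Inf K) < \<delta>"
        using l1 \<open>\<delta>' \<le> \<delta>\<close> l1_eq by linarith
    qed
    finally have bad: "- e < (\<Sum>(t, K)\<in>p1. g (Sup K) - g (Inf K))"
      by linarith
    have good: "(\<Sum>(t, K)\<in>p - p1. (c - e) * (Sup K - Inf K)) \<le> (\<Sum>(t, K)\<in>p - p1. g (Sup K) - g (Inf K))"
    proof (rule sum_mono, clarify)
      fix t K
      assume tK: "(t, K) \<in> p" "(t, K) \<notin> p1"
      then have "t \<notin> N" by (auto simp: p1_def)
      obtain u v where uv: "Inf K = u" "Sup K = v" "u \<le> t" "t \<le> v" "t \<in> {a..b}"
          "u \<in> {a..b}" "v \<in> {a..b}" "\<bar>u - t\<bar> < r t" "\<bar>v - t\<bar> < r t"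
        using piece[OF tK(1)] by blast
      have "(c - e) * (v - t) \<le> g v - g t" "(c - e) * (t - u) \<le> g t - g u"
        using rD[of t v] rD[of t u] uv \<open>t \<notin> N\<close> by blast+
      then show "(c - e) * (Sup K - Inf K) \<le> g (Sup K) - g (Inf K)"
        by (simp add: uv algebra_simps)
    qed
    have split: "(\<Sum>(t, K)\<in>p. h (Sup K) - h (Inf K)) =
        (\<Sum>(t, K)\<in>p1. h (Sup K) - h (Inf K)) + (\<Sum>(t, K)\<in>p - p1. h (Sup K) - h (Inf K))"
      for h :: "real \<Rightarrow> real"
      using sum.subset_diff[OF \<open>p1 \<subseteq> p\<close> fin, of "\<lambda>(t, K). h (Sup K) - h (Inf K)"] by simp
    have total: "(\<Sum>(t, K)\<in>p. h (Sup K) - h (Inf K)) = h b - h a" for h :: "real \<Rightarrow> real"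
      using additive_tagged_division_1[OF \<open>a \<le> b\<close> p] .
    have "(\<Sum>(t, K)\<in>p - p1. Sup K - Inf K) = b - a - l1"
      using split[of "\<lambda>s. s"] total[of "\<lambda>s. s"] by (simp add: l1_def)
    moreover have "(\<Sum>(t, K)\<in>p - p1. (c - e) * (Sup K - Inf K)) =
        (c - e) * (\<Sum>(t, K)\<in>p - p1. Sup K - Inf K)"
      by (simp add: sum_distrib_left case_prod_unfold)
    ultimately have "(\<Sum>(t, K)\<in>p - p1. (c - e) * (Sup K - Inf K)) = (c - e) * (b - a - l1)"
      by simp
    then have "(c - e) * (b - a - l1) - e \<le> g b - g a"
      using good bad split[of g] total[of g] by linarith
    then show ?thesis
      using small[OF l1] by (simp add: algebra_simps)
  qed
  show ?thesis
  proof (rule field_le_epsilon)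
    fix d :: real
    assume "d > 0"
    then show "c * (b - a) \<le> g b - g a + d"
      using main[of "d / (2 + (b - a))"] \<open>a \<le> b\<close> by simp
  qed
qed

lemma abs_continuous_on_imp_continuous_on:
  fixes z :: "real \<Rightarrow> 'a::real_normed_vector"
  assumes "abs_continuous_on {a..b} z"
  shows "continuous_on {a..b} z"
  unfolding continuous_on_iff
proof (intro ballI allI impI)
  fix t e :: real
  assume t: "t \<in> {a..b}" and "e > 0"
  then obtain \<delta> where "\<delta> > 0" and \<delta>: "\<And>D. D division_of \<Union>D \<and> \<Union>D \<subseteq> {a..b} \<and>
      (\<Sum>K\<in>D. Sup K - Inf K) < \<delta> \<Longrightarrow> (\<Sum>K\<in>D. norm (z (Sup K) - z (Inf K))) < e"
    using assms[unfolded abs_continuous_on_def, rule_format, OF \<open>e > 0\<close>] by blast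
  have "dist (z s) (z t) < e" if "s \<in> {a..b}" "dist s t < \<delta>" for s
  proof -
    define u v where "u = min s t" and "v = max s t"
    have "{{u..v}} division_of {u..v}"
      using division_of_self[of u v] by (simp add: u_def v_def)
    moreover have "u \<le> v" "{u..v} \<subseteq> {a..b}" "v - u < \<delta>"
      using t that by (auto simp: u_def v_def dist_real_def)
    ultimately have "norm (z v - z u) < e"
      using \<delta>[of "{{u..v}}"] by simp
    then show ?thesis
      by (cases "s \<le> t") (simp_all add: u_def v_def dist_norm norm_minus_commute)
  qed
  then show "\<exists>d>0. \<forall>s\<in>{a..b}. dist s t < d \<longrightarrow> dist (z s) (z t) < e"
    using \<open>\<delta> > 0\<close> by blast
qed

lemma abs_continuous_on_subset:
  assumes "abs_continuous_on S g" and "T \<subseteq> S"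
  shows "abs_continuous_on T g"
  unfolding abs_continuous_on_def
proof (intro allI impI)
  fix e :: real
  assume "e > 0"
  then obtain \<delta> where "\<delta> > 0" and \<delta>: "\<forall>D. D division_of \<Union>D \<and> \<Union>D \<subseteq> S \<and> (\<Sum>K\<in>D. Sup K - Inf K) < \<delta> \<longrightarrow>
      (\<Sum>K\<in>D. norm (g (Sup K) - g (Inf K))) < e"
    using assms(1)[unfolded abs_continuous_on_def, rule_format, OF \<open>e > 0\<close>] by blast
  have "\<forall>D. D division_of \<Union>D \<and> \<Union>D \<subseteq> T \<and> (\<Sum>K\<in>D. Sup K - Inf K) < \<delta> \<longrightarrow>
      (\<Sum>K\<in>D. norm (g (Sup K) - g (Inf K))) < e"
    using \<delta> order_trans[OF _ assms(2)] by auto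
  with \<open>\<delta> > 0\<close> show "\<exists>\<delta>>0. \<forall>D. D division_of \<Union>D \<and> \<Union>D \<subseteq> T \<and> (\<Sum>K\<in>D. Sup K - Inf K) < \<delta> \<longrightarrow>
      (\<Sum>K\<in>D. norm (g (Sup K) - g (Inf K))) < e"
    by blast
qed

lemma abs_continuous_on_dominated:
  fixes z :: "real \<Rightarrow> 'a::real_normed_vector" and g :: "real \<Rightarrow> 'b::real_normed_vector"
  assumes "abs_continuous_on S z"
    and "\<And>s t. s \<in> S \<Longrightarrow> t \<in> S \<Longrightarrow> norm (g s - g t) \<le> L * norm (z s - z t)"
  shows "abs_continuous_on S g"
  unfolding abs_continuous_on_def
proof (intro allI impI)
  fix e :: real
  assume "e > 0"
  define M where "M = \<bar>L\<bar> + 1"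
  have "M > 0" by (simp add: M_def)
  have dom: "norm (g s - g t) \<le> M * norm (z s - z t)" if "s \<in> S" "t \<in> S" for s t
    using assms(2)[OF that] mult_right_mono[of L M "norm (z s - z t)"] by (fastforce simp: M_def)
  have "e / M > 0"
    using \<open>e > 0\<close> \<open>M > 0\<close> by simp
  then obtain \<delta> where "\<delta> > 0" and \<delta>: "\<And>D. D division_of \<Union>D \<and> \<Union>D \<subseteq> S \<and>
      (\<Sum>K\<in>D. Sup K - Inf K) < \<delta> \<Longrightarrow> (\<Sum>K\<in>D. norm (z (Sup K) - z (Inf K))) < e / M"
    using assms(1)[unfolded abs_continuous_on_def, rule_format, OF \<open>e / M > 0\<close>] by blast
  show "\<exists>\<delta>>0. \<forall>D. D division_of \<Union>D \<and> \<Union>D \<subseteq> S \<and> (\<Sum>K\<in>D. Sup K - Inf K) < \<delta> \<longrightarrow>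
      (\<Sum>K\<in>D. norm (g (Sup K) - g (Inf K))) < e"
  proof (intro exI[of _ \<delta>] conjI allI impI \<open>\<delta> > 0\<close>)
    fix D
    assume D: "D division_of \<Union>D \<and> \<Union>D \<subseteq> S \<and> (\<Sum>K\<in>D. Sup K - Inf K) < \<delta>"
    have ends: "Sup K \<in> S" "Inf K \<in> S" if "K \<in> D" for K
    proof -
      note KD = that
      obtain u v where "K = cbox u v"
        using division_ofD(4)[OF conjunct1[OF D] KD] by blast
      then have "K = {u..v}" by simp
      moreover have "K \<noteq> {}"
        using division_ofD(3)[of D "\<Union>D" K] D that by blast
      ultimately have "Sup K \<in> K" "Inf K \<in> K" by auto
      then show "Sup K \<in> S" "Inf K \<in> S"
        using D that by blast+
    qed
    have "(\<Sum>K\<in>D. norm (g (Sup K) - g (Inf K))) \<le> (\<Sum>K\<in>D. M * norm (z (Sup K) - z (Inf K)))"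
      using ends dom by (intro sum_mono) auto
    also have "\<dots> = M * (\<Sum>K\<in>D. norm (z (Sup K) - z (Inf K)))"
      by (simp add: sum_distrib_left)
    also have "\<dots> < e"
      using \<delta>[OF D] \<open>M > 0\<close> by (simp add: field_simps)
    finally show "(\<Sum>K\<in>D. norm (g (Sup K) - g (Inf K))) < e" .
  qed
qed


section \<open>The Clarke subdifferential\<close>

text \<open>A bound on the difference quotients that holds on a neighbourhood of \<open>x\<close> holds near every point of
  its interior.\<close>

lemma clarke_dirderiv_upper_semicontinuous:
  assumes "clarke_dirderiv f x d < c"
  shows "\<forall>\<^sub>F y in nhds x. clarke_dirderiv f y d \<le> c"
proof -
  obtain P Q where P: "eventually P (nhds x)" and Q: "eventually Q (at_right 0)"
    and PQ: "\<And>y t. P y \<Longrightarrow> Q t \<Longrightarrow> ereal ((f (y + t *\<^sub>R d) - f y) / t) < c"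
    using Limsup_lessD[OF assms[unfolded clarke_dirderiv_def]]
    by (auto simp: eventually_prod_filter)
  have "\<forall>\<^sub>F y in nhds x. eventually P (nhds y)"
    using P by (simp add: eventually_eventually)
  then show ?thesis
  proof eventually_elim
    case (elim y)
    have "\<forall>\<^sub>F (z, t) in nhds y \<times>\<^sub>F at_right 0. ereal ((f (z + t *\<^sub>R d) - f z) / t) \<le> c"
      using elim Q PQ unfolding eventually_prod_filter by (fastforce intro: less_imp_le)
    then show ?case
      unfolding clarke_dirderiv_def by (intro Limsup_bounded) (simp add: case_prod_unfold)
  qed
qed

text \<open>Each of the inequalities that define the subdifferential passes to the limit by upper semicontinuity of
  the directional derivative.\<close>

lemma clarke_subdiff_closed_graph:
  assumes "y \<longlonglongrightarrow> x" and "v \<longlonglongrightarrow> w" and "\<And>n. v n \<in> clarke_subdiff f (y n)"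
  shows "w \<in> clarke_subdiff f x"
proof -
  have "ereal (w \<bullet> d) \<le> clarke_dirderiv f x d" for d
  proof (rule ccontr)
    assume "\<not> ?thesis"
    then obtain r where r: "clarke_dirderiv f x d < ereal r" "r < w \<bullet> d"
      using ereal_dense2[of "clarke_dirderiv f x d" "ereal (w \<bullet> d)"] by (auto simp: not_le)
    have "\<forall>\<^sub>F n in sequentially. clarke_dirderiv f (y n) d \<le> ereal r"
      using clarke_dirderiv_upper_semicontinuous[OF r(1)] assms(1)
      by (auto simp: filterlim_iff)
    then have "\<forall>\<^sub>F n in sequentially. v n \<bullet> d \<le> r"
    proof eventually_elim
      case (elim n)
      then have "ereal (v n \<bullet> d) \<le> ereal r"
        using assms(3)[of n] unfolding clarke_subdiff_def by (blast intro: order_trans)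
      then show ?case by simp
    qed
    moreover have "(\<lambda>n. v n \<bullet> d) \<longlonglongrightarrow> w \<bullet> d"
      using assms(2) by (intro tendsto_intros)
    ultimately have "w \<bullet> d \<le> r"
      by (intro tendsto_upperbound) auto
    then show False using r(2) by simp
  qed
  then show ?thesis by (simp add: clarke_subdiff_def)
qed

text \<open>Test the defining inequality of \<open>v\<close> with the direction \<open>v\<close> itself: near \<open>y\<close>, the difference quotients
  are at most \<open>L * norm v\<close>.\<close>

lemma norm_clarke_subdiff_le:
  assumes "open U" "y \<in> U" and f: "L-lipschitz_on U f" and v: "v \<in> clarke_subdiff f y"
  shows "norm v \<le> L"
proof (cases "v = 0")
  case True
  then show ?thesis using lipschitz_on_nonneg[OF f] by simp
next
  case False
  have "(fst \<longlongrightarrow> y) (nhds y \<times>\<^sub>F at_right (0::real))"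
    by (rule filterlim_fst)
  moreover have "((\<lambda>p. fst p + snd p *\<^sub>R v) \<longlongrightarrow> y + 0 *\<^sub>R v) (nhds y \<times>\<^sub>F at_right (0::real))"
    by (intro tendsto_intros filterlim_fst filterlim_compose[OF _ filterlim_snd] tendsto_ident_at)
  ultimately have "\<forall>\<^sub>F p in nhds y \<times>\<^sub>F at_right (0::real). fst p \<in> U"
    "\<forall>\<^sub>F p in nhds y \<times>\<^sub>F at_right (0::real). fst p + snd p *\<^sub>R v \<in> U"
    using assms(1,2) by (auto intro: topological_tendstoD)
  moreover have "\<forall>\<^sub>F p in nhds y \<times>\<^sub>F at_right (0::real). snd p > 0"
    using filterlim_snd[of "at_right (0::real)" "nhds y"] eventually_at_right_less[of "0::real"]
    by (auto simp: filterlim_iff)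
  ultimately have "\<forall>\<^sub>F (z, t) in nhds y \<times>\<^sub>F at_right 0. ereal ((f (z + t *\<^sub>R v) - f z) / t) \<le> ereal (L * norm v)"
  proof eventually_elim
    case (elim p)
    have "f (fst p + snd p *\<^sub>R v) - f (fst p) \<le> L * dist (fst p + snd p *\<^sub>R v) (fst p)"
      using lipschitz_onD[OF f elim(2,1)] by (simp add: dist_real_def)
    then show ?case
      using elim(3) by (simp add: case_prod_unfold dist_norm divide_le_eq mult_ac)
  qed
  then have "clarke_dirderiv f y v \<le> ereal (L * norm v)"
    unfolding clarke_dirderiv_def by (intro Limsup_bounded) (simp add: case_prod_unfold)
  moreover have "ereal (v \<bullet> v) \<le> clarke_dirderiv f y v"
    using v by (simp add: clarke_subdiff_def)
  ultimately have "ereal (v \<bullet> v) \<le> ereal (L * norm v)"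
    by (rule order_trans[rotated])
  then have "norm v * norm v \<le> L * norm v"
    by (simp add: dot_square_norm power2_eq_square)
  then show ?thesis
    using False by simp
qed

lemma clarke_subdiff_locally_bounded:
  assumes "locally_lipschitz f"
  obtains L where "\<forall>\<^sub>F y in nhds x. \<forall>v\<in>clarke_subdiff f y. norm v \<le> L"
proof -
  obtain u L where u: "u > 0" "L-lipschitz_on (cball x u) f"
    using assms unfolding locally_lipschitz_def by blast
  then have L: "L-lipschitz_on (ball x u) f"
    by (auto intro: lipschitz_on_subset)
  have "\<forall>\<^sub>F y in nhds x. y \<in> ball x u"
    using u(1) by (intro eventually_nhds_in_open) auto
  then have "\<forall>\<^sub>F y in nhds x. \<forall>v\<in>clarke_subdiff f y. norm v \<le> L"
    by eventually_elim (use norm_clarke_subdiff_le[OF _ _ L] in auto)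
  then show thesis by (rule that)
qed

lemma convex_clarke_subdiff: "convex (clarke_subdiff f x)"
proof -
  have "clarke_subdiff f x = (\<Inter>d. {v. ereal (v \<bullet> d) \<le> clarke_dirderiv f x d})"
    by (auto simp: clarke_subdiff_def)
  moreover have "convex {v. ereal (v \<bullet> d) \<le> clarke_dirderiv f x d}" for d
    using convex_halfspace_le[of d] by (cases "clarke_dirderiv f x d") (simp_all add: inner_commute)
  ultimately show ?thesis by (auto intro: convex_INT)
qed

lemma compact_clarke_subdiff:
  fixes f :: "'a::euclidean_space \<Rightarrow> real"
  assumes "locally_lipschitz f"
  shows "compact (clarke_subdiff f x)"
proof -
  obtain L where "\<forall>\<^sub>F y in nhds x. \<forall>v\<in>clarke_subdiff f y. norm v \<le> L"
    using clarke_subdiff_locally_bounded[OF assms] by blast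
  then have "\<forall>v\<in>clarke_subdiff f x. norm v \<le> L"
    by (rule eventually_nhds_x_imp_x)
  moreover have "closed (clarke_subdiff f x)"
    unfolding closed_sequential_limits
    using clarke_subdiff_closed_graph[OF tendsto_const] by blast
  ultimately show ?thesis
    by (auto simp: compact_eq_bounded_closed bounded_iff)
qed

text \<open>Otherwise there are subgradients at points converging to \<open>x\<close> that violate the bound. They are bounded,
  so a subsequence converges, and by the closed graph its limit is a subgradient at \<open>x\<close> that violates it
  as well.\<close>

lemma clarke_subdiff_upper_semicontinuous:
  fixes f :: "'a::euclidean_space \<Rightarrow> real"
  assumes "locally_lipschitz f" and "\<And>v. v \<in> clarke_subdiff f x \<Longrightarrow> v \<bullet> d < c"
  shows "\<forall>\<^sub>F y in nhds x. \<forall>v\<in>clarke_subdiff f y. v \<bullet> d < c"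
proof (rule ccontr)
  assume notev: "\<not> ?thesis"
  obtain L where L: "\<forall>\<^sub>F y in nhds x. \<forall>v\<in>clarke_subdiff f y. norm v \<le> L"
    using clarke_subdiff_locally_bounded[OF assms(1)] by blast
  have "\<exists>y v. dist y x < inverse (real (Suc n)) \<and> v \<in> clarke_subdiff f y \<and> norm v \<le> L \<and> c \<le> v \<bullet> d" for n
  proof -
    have "\<exists>\<^sub>F y in nhds x. \<exists>v\<in>clarke_subdiff f y. c \<le> v \<bullet> d"
      using notev by (simp add: frequently_def not_le)
    moreover have "\<forall>\<^sub>F y in nhds x. dist y x < inverse (real (Suc n)) \<and> (\<forall>v\<in>clarke_subdiff f y. norm v \<le> L)"
      using L by (intro eventually_conj) (auto simp: eventually_nhds_metric simp del: of_nat_Suc intro!: exI[of _ "inverse (real (Suc n))"])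
    ultimately show ?thesis
      by (blast dest: frequently_eventually_frequently frequently_ex)
  qed
  then obtain y v where y: "\<And>n. dist (y n) x < inverse (real (Suc n))"
    and v: "\<And>n. v n \<in> clarke_subdiff f (y n)" "\<And>n. v n \<in> cball 0 L" "\<And>n. c \<le> v n \<bullet> d"
    by (simp del: of_nat_Suc) metis
  have "y \<longlonglongrightarrow> x"
    by (rule metric_tendsto_imp_tendsto[OF LIMSEQ_inverse_real_of_nat])
      (use y in \<open>auto simp del: of_nat_Suc intro!: always_eventually less_imp_le\<close>)
  obtain w r where w: "strict_mono r" "(v \<circ> r) \<longlonglongrightarrow> w"
    using compact_cball[of "0::'a" L] v(2) unfolding compact_def by metis
  have "w \<in> clarke_subdiff f x"
  proof (rule clarke_subdiff_closed_graph)
    show "(y \<circ> r) \<longlonglongrightarrow> x"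
      using \<open>y \<longlonglongrightarrow> x\<close> w(1) by (rule LIMSEQ_subseq_LIMSEQ)
  qed (use w v in auto)
  then have "w \<bullet> d < c" by (rule assms(2))
  moreover have "(\<lambda>n. (v \<circ> r) n \<bullet> d) \<longlonglongrightarrow> w \<bullet> d"
    using w(2) by (intro tendsto_intros)
  then have "c \<le> w \<bullet> d"
    by (rule tendsto_lowerbound) (use v(3) in auto)
  ultimately show False by simp
qed


section \<open>Feasible directions at the boundary of the orthant\<close>

lemma open_pos_orthant: "open (pos_orthant :: (real ^ 'n) set)"
proof -
  have "open (\<Inter>i. {x :: real ^ 'n. 0 < x $ i})"
    by (rule open_INT) (simp_all add: open_halfspace_component_gt_cart)
  moreover have "(\<Inter>i. {x :: real ^ 'n. 0 < x $ i}) = pos_orthant"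
    by (auto simp: pos_orthant_def)
  ultimately show ?thesis
    by (rule subst[rotated])
qed

lemma closure_pos_orthant: "closure pos_orthant = {x :: real ^ 'n. \<forall>i. 0 \<le> x $ i}"
proof
  show "closure pos_orthant \<subseteq> {x :: real ^ 'n. \<forall>i. 0 \<le> x $ i}"
    by (intro closure_minimal closed_positive_orthant) (auto simp: pos_orthant_def intro: less_imp_le)
  show "{x :: real ^ 'n. \<forall>i. 0 \<le> x $ i} \<subseteq> closure pos_orthant"
  proof
    fix x :: "real ^ 'n"
    assume x: "x \<in> {x. \<forall>i. 0 \<le> x $ i}"
    have "(\<lambda>k. x + inverse (real (Suc k)) *\<^sub>R 1) \<longlonglongrightarrow> x + 0 *\<^sub>R 1"
      by (intro tendsto_intros LIMSEQ_inverse_real_of_nat)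
    moreover have "x + inverse (real (Suc k)) *\<^sub>R 1 \<in> pos_orthant" for k
      using x by (auto simp: pos_orthant_def intro!: add_nonneg_pos)
    ultimately show "x \<in> closure pos_orthant"
      unfolding closure_sequential
      by (intro exI[of _ "\<lambda>k. x + inverse (real (Suc k)) *\<^sub>R 1"]) simp
  qed
qed

lemma convex_cone_normal_cone:
  assumes "x \<in> S"
  shows "convex_cone (normal_cone S x)"
  using assms unfolding convex_cone_iff normal_cone_def
  by (simp add: inner_add_left mult_nonneg_nonpos add_nonpos_nonpos)

lemma inner_transpose_matrix_vector:
  fixes A :: "real ^ 'n ^ 'm"
  shows "d \<bullet> (transpose A *v y) = (A *v d) \<bullet> y"
  by (metis dot_lmul_matrix inner_commute transpose_matrix_vector)

text \<open>The theorem of the alternative behind the proof. If no \<open>- v\<close> with \<open>v \<in> S\<close> lies in the cone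
  \<open>range A\<^sup>T + N\<close>, the compact set \<open>- S\<close> can be strictly separated from the cone spanned by the
  columns of \<open>A\<^sup>T\<close>, their negatives, and the vectors \<open>- e\<^sub>i\<close> with \<open>xs\<^sub>i = 0\<close>. A nonpositive
  inner product of \<open>d\<close> with each generator says exactly that \<open>d\<close> is a feasible direction at \<open>xs\<close>.\<close>

lemma separating_feasible_direction:
  fixes A :: "real ^ 'n ^ 'm" and xs :: "real ^ 'n"
  assumes S: "compact S" "convex S"
    and xs: "xs \<in> closure pos_orthant"
    and disj: "\<And>v. v \<in> S \<Longrightarrow> - v \<notin> range (\<lambda>y. transpose A *v y) + normal_cone (closure pos_orthant) xs"
  obtains d c where "A *v d = 0" and "\<And>i. xs $ i = 0 \<Longrightarrow> 0 \<le> d $ i"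
    and "c > 0" and "\<And>v. v \<in> S \<Longrightarrow> v \<bullet> d < - c"
proof (cases "S = {}")
  case True
  \<comment> \<open>Strict separation needs \<open>S\<close> nonempty; for empty \<open>S\<close> the zero direction is feasible and the bound
      on \<open>S\<close> is vacuous.\<close>
  then show thesis
    by (intro that[of 0 1]) auto
next
  case False
  let ?R = "range (\<lambda>y. transpose A *v y)" and ?N = "normal_cone (closure pos_orthant) xs"
  \<comment> \<open>Finitely many generators of a subcone: it is closed because it is finitely generated, which
      strict separation needs.\<close>
  define F where "F = range (\<lambda>k. transpose A *v axis k 1) \<union> range (\<lambda>k. - (transpose A *v axis k 1)) \<union>
      (\<lambda>i. - axis i 1) ` {i. xs $ i = 0}"
  have "?R + ?N = (\<Union>u\<in>?R. \<Union>w\<in>?N. {u + w})"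
    by (auto simp: set_plus_def)
  moreover have "subspace ?R"
    by (intro linear_subspace_image) (simp_all add: matrix_vector_mul_linear del: transpose_matrix_vector)
  ultimately have cone: "convex_cone (?R + ?N)"
    using convex_cone_sums[OF subspace_imp_convex_cone convex_cone_normal_cone[OF xs]] by metis
  have "0 \<in> ?R" "0 \<in> ?N"
    using \<open>subspace ?R\<close> xs by (auto simp: subspace_0 normal_cone_def)
  have "F \<subseteq> ?R + ?N"
  proof -
    have "u \<in> ?R + ?N" if "u \<in> ?R" for u
      using set_plus_intro[OF that \<open>0 \<in> ?N\<close>] by simp
    moreover have "u \<in> ?R + ?N" if "u \<in> ?N" for u
      using set_plus_intro[OF \<open>0 \<in> ?R\<close> that] by simp
    moreover have "- axis i 1 \<in> ?N" if "xs $ i = 0" for i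
      using that xs by (auto simp: normal_cone_def closure_pos_orthant inner_axis' algebra_simps)
    moreover have "- (transpose A *v axis k 1) \<in> ?R" for k
      using subspace_neg[OF \<open>subspace ?R\<close>] by blast
    ultimately show ?thesis
      by (auto simp: F_def)
  qed
  then have sub: "convex_cone hull F \<subseteq> ?R + ?N"
    using cone by (simp add: hull_minimal)
  have "finite F"
    by (simp add: F_def)
  then have "closed (convex_cone hull F)"
    by (rule closed_convex_cone_hull)
  moreover have "uminus ` S \<inter> convex_cone hull F = {}"
    using disj sub by blast
  moreover have "compact (uminus ` S)" "convex (uminus ` S)"
    using S by (auto intro: compact_negations convex_negations)
  ultimately have "\<exists>a \<beta>. (\<forall>v\<in>uminus ` S. a \<bullet> v < \<beta>) \<and> (\<forall>w\<in>convex_cone hull F. \<beta> < a \<bullet> w)"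
    using False by (intro separating_hyperplane_compact_closed convex_convex_cone_hull) auto
  then obtain a \<beta> where a: "\<And>v. v \<in> S \<Longrightarrow> a \<bullet> (- v) < \<beta>" "\<And>w. w \<in> convex_cone hull F \<Longrightarrow> \<beta> < a \<bullet> w"
    by blast
  have "\<beta> < 0"
    using a(2)[OF convex_cone_hull_contains_0] by simp
  have nonneg: "0 \<le> a \<bullet> w" if "w \<in> F" for w
  proof (rule ccontr)
    assume neg: "\<not> ?thesis"
    \<comment> \<open>Rescaling \<open>w\<close> by this positive factor would put a point of the cone on the separating hyperplane.\<close>
    have "(\<beta> / (a \<bullet> w)) *\<^sub>R w \<in> convex_cone hull F"
      using neg \<open>\<beta> < 0\<close> hull_inc[OF that] by (intro convex_cone_hull_mul) (auto intro: divide_nonpos_nonpos)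
    from a(2)[OF this] show False
      using neg by simp
  qed
  show thesis
  proof (rule that[of "- a" "- \<beta>"])
    have "a \<bullet> (transpose A *v axis k 1) = 0" for k
      using nonneg[of "transpose A *v axis k 1"] nonneg[of "- (transpose A *v axis k 1)"]
      by (auto simp: F_def)
    then have "(A *v a) $ k = 0" for k
      by (simp add: inner_transpose_matrix_vector inner_axis del: transpose_matrix_vector)
    then show "A *v (- a) = 0"
      using matrix_vector_mult_diff_distrib[of A 0 a] by (simp add: vec_eq_iff)
    show "0 \<le> (- a) $ i" if "xs $ i = 0" for i
      using nonneg[of "- axis i 1"] that by (auto simp: F_def inner_axis)
    show "- \<beta> > 0"
      using \<open>\<beta> < 0\<close> by simp
    show "v \<bullet> (- a) < - (- \<beta>)" if "v \<in> S" for v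
      using a(1)[OF that] by (simp add: inner_commute)
  qed
qed


section \<open>Separable kernels and the mirror variable\<close>

lemma separable_kernel_derivatives:
  fixes \<phi> :: "real ^ 'n \<Rightarrow> real"
  assumes "separable_kernel \<phi>"
  obtains q q' q'' :: "'n \<Rightarrow> real \<Rightarrow> real"
  where "\<And>y. y \<in> pos_orthant \<Longrightarrow> \<phi> y = (\<Sum>i\<in>UNIV. q i (y $ i))"
    and "\<And>i t. t > 0 \<Longrightarrow> (q i has_real_derivative q' i t) (at t)"
    and "\<And>i t. t > 0 \<Longrightarrow> (q' i has_real_derivative q'' i t) (at t)"
    and "\<And>i t. t > 0 \<Longrightarrow> q'' i t > 0"
    and "\<And>i. continuous_on {0<..} (q'' i)"
proof -
  obtain q :: "'n \<Rightarrow> real \<Rightarrow> real" and \<gamma> :: real and \<psi> :: "'n \<Rightarrow> real \<Rightarrow> real"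
    where q: "\<And>y. y \<in> pos_orthant \<Longrightarrow> \<phi> y = (\<Sum>i\<in>UNIV. q i (y $ i))"
      "\<And>i. q i differentiable_on {0<..}"
    and \<psi>: "\<And>i. continuous_on UNIV (\<psi> i)" "\<And>i t. \<psi> i t > 0"
      "\<And>i t. t > 0 \<Longrightarrow> (deriv (q i) has_real_derivative t powr (- \<gamma>) * \<psi> i t) (at t)"
    using assms unfolding separable_kernel_def by blast
  show thesis
  proof (rule that[of q "\<lambda>i. deriv (q i)" "\<lambda>i t. t powr (- \<gamma>) * \<psi> i t"])
    show "(q i has_real_derivative deriv (q i) t) (at t)" if "t > 0" for i t
    proof -
      have "q i differentiable (at t)"
        using q(2)[of i] that by (simp add: differentiable_on_eq_differentiable_at)
      then show ?thesis
        by (simp add: DERIV_deriv_iff_real_differentiable)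
    qed
    show "continuous_on {0<..} (\<lambda>t. t powr (- \<gamma>) * \<psi> i t)" for i
      by (intro continuous_intros continuous_on_subset[OF \<psi>(1)]) auto
  qed (use q \<psi> in auto)
qed

text \<open>The image of the compact interval under each coordinate of the curve is a compact subinterval of
  \<open>(0,\<infinity>)\<close>, on which \<open>h i\<close> is Lipschitz because its derivative is continuous.\<close>

lemma abs_continuous_on_separable_comp:
  fixes z :: "real \<Rightarrow> real ^ 'n"
  assumes ac: "abs_continuous_on {a..b} z"
    and pos: "\<And>t. t \<in> {a..b} \<Longrightarrow> z t \<in> pos_orthant"
    and deriv: "\<And>i s. s > 0 \<Longrightarrow> (h i has_real_derivative h' i s) (at s)"
    and cont: "\<And>i. continuous_on {0<..} (h' i)"
  shows "abs_continuous_on {a..b} (\<lambda>t. \<Sum>i\<in>UNIV. d $ i * h i (z t $ i))"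
proof -
  have "\<exists>B\<ge>0. \<forall>s\<in>{a..b}. \<forall>t\<in>{a..b}. \<bar>h i (z s $ i) - h i (z t $ i)\<bar> \<le> B * norm (z s - z t)" for i
  proof (cases "a \<le> b")
    case True
    define J where "J = (\<lambda>t. z t $ i) ` {a..b}"
    have "continuous_on {a..b} (\<lambda>t. z t $ i)"
      using abs_continuous_on_imp_continuous_on[OF ac] by (intro continuous_intros)
    then have "compact J" "connected J"
      unfolding J_def by (auto intro: compact_continuous_image connected_continuous_image)
    have J: "J \<subseteq> {0<..}"
      using pos by (auto simp: J_def pos_orthant_def)
    have "compact (h' i ` J)"
      using \<open>compact J\<close> J cont by (intro compact_continuous_image) (auto intro: continuous_on_subset)
    then obtain B where B: "\<And>s. s \<in> J \<Longrightarrow> \<bar>h' i s\<bar> \<le> B"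
      by (force dest!: compact_imp_bounded simp: bounded_iff)
    have "convex J"
      using \<open>connected J\<close> by (simp add: connected_convex_1)
    have "B \<ge> 0"
      using B[of "z a $ i"] True by (auto simp: J_def)
    have "\<bar>h i (z s $ i) - h i (z t $ i)\<bar> \<le> B * norm (z s - z t)" if "s \<in> {a..b}" "t \<in> {a..b}" for s t
    proof -
      have "norm (h i (z s $ i) - h i (z t $ i)) \<le> B * norm (z s $ i - z t $ i)"
      proof (rule field_differentiable_bound[OF \<open>convex J\<close>])
        show "(h i has_real_derivative h' i r) (at r within J)" if "r \<in> J" for r
          using deriv J that by (auto intro: has_field_derivative_at_within)
      qed (use B that in \<open>auto simp: J_def\<close>)
      also have "\<dots> \<le> B * norm (z s - z t)"
        using \<open>B \<ge> 0\<close> component_le_norm_cart[of "z s - z t" i] by (intro mult_left_mono) auto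
      finally show ?thesis by simp
    qed
    then show ?thesis
      using \<open>B \<ge> 0\<close> by blast
  qed auto
  then obtain B where B: "\<And>i s t. s \<in> {a..b} \<Longrightarrow> t \<in> {a..b} \<Longrightarrow>
      \<bar>h i (z s $ i) - h i (z t $ i)\<bar> \<le> B i * norm (z s - z t)"
    by metis
  show ?thesis
  proof (rule abs_continuous_on_dominated[OF ac])
    fix s t
    assume st: "s \<in> {a..b}" "t \<in> {a..b}"
    have "norm ((\<Sum>i\<in>UNIV. d $ i * h i (z s $ i)) - (\<Sum>i\<in>UNIV. d $ i * h i (z t $ i)))
        = \<bar>\<Sum>i\<in>UNIV. d $ i * (h i (z s $ i) - h i (z t $ i))\<bar>"
      by (simp add: sum_subtractf right_diff_distrib)
    also have "\<dots> \<le> (\<Sum>i\<in>UNIV. \<bar>d $ i\<bar> * \<bar>h i (z s $ i) - h i (z t $ i)\<bar>)"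
      by (rule order_trans[OF sum_abs]) (simp add: abs_mult)
    also have "\<dots> \<le> (\<Sum>i\<in>UNIV. \<bar>d $ i\<bar> * (B i * norm (z s - z t)))"
      using B[OF st] by (intro sum_mono mult_left_mono) auto
    also have "\<dots> = (\<Sum>i\<in>UNIV. \<bar>d $ i\<bar> * B i) * norm (z s - z t)"
      by (simp add: sum_distrib_right mult.assoc)
    finally show "norm ((\<Sum>i\<in>UNIV. d $ i * h i (z s $ i)) - (\<Sum>i\<in>UNIV. d $ i * h i (z t $ i)))
        \<le> (\<Sum>i\<in>UNIV. \<bar>d $ i\<bar> * B i) * norm (z s - z t)" .
  qed
qed

text \<open>Here \<open>h\<close> is the derivative of the kernel, coordinate by coordinate. A coordinate with positive limit
  contributes a convergent term. If the limit is zero, then \<open>h i\<close>, being increasing, eventually stays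
  below its value at 1, and its coefficient is nonnegative.\<close>

lemma eventually_kernel_pairing_bounded:
  fixes x :: "'b \<Rightarrow> real ^ 'n"
  assumes lim: "(x \<longlongrightarrow> xs) F"
    and pos: "\<forall>\<^sub>F t in F. x t \<in> pos_orthant"
    and deriv: "\<And>i s. s > 0 \<Longrightarrow> (h i has_real_derivative h' i s) (at s)"
    and h'_pos: "\<And>i s. s > 0 \<Longrightarrow> h' i s > 0"
    and xs: "xs \<in> closure pos_orthant"
    and d: "\<And>i. xs $ i = 0 \<Longrightarrow> 0 \<le> d $ i"
  obtains B where "\<forall>\<^sub>F t in F. (\<Sum>i\<in>UNIV. d $ i * h i (x t $ i)) \<le> B"
proof -
  have "\<exists>B. \<forall>\<^sub>F t in F. d $ i * h i (x t $ i) \<le> B" for i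
  proof (cases "xs $ i = 0")
    case True
    have lim_i: "((\<lambda>t. x t $ i) \<longlongrightarrow> 0) F"
      using lim True by (metis tendsto_vec_nth)
    have "\<forall>\<^sub>F t in F. x t $ i < 1"
      using order_tendstoD(2)[OF lim_i] by simp
    then have "\<forall>\<^sub>F t in F. d $ i * h i (x t $ i) \<le> d $ i * h i 1"
      using pos
    proof eventually_elim
      case (elim t)
      have "h i (x t $ i) \<le> h i 1"
      proof (rule DERIV_nonneg_imp_nondecreasing[where f = "h i"])
        show "x t $ i \<le> 1"
          using elim by simp
        show "\<exists>y. (h i has_real_derivative y) (at s) \<and> 0 \<le> y" if "x t $ i \<le> s" "s \<le> 1" for s
        proof -
          have "s > 0"
            using elim(2) that(1) by (auto simp: pos_orthant_def intro: less_le_trans)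
          then show ?thesis
            using deriv h'_pos less_imp_le by blast
        qed
      qed
      then show ?case
        using d[OF True] by (rule mult_left_mono)
    qed
    then show ?thesis ..
  next
    case False
    then have "xs $ i > 0"
      using xs by (simp add: closure_pos_orthant less_le)
    then have "isCont (h i) (xs $ i)"
      using deriv DERIV_isCont by blast
    then have "((\<lambda>t. h i (x t $ i)) \<longlongrightarrow> h i (xs $ i)) F"
      by (rule isCont_tendsto_compose) (intro tendsto_intros lim)
    then have "((\<lambda>t. d $ i * h i (x t $ i)) \<longlongrightarrow> d $ i * h i (xs $ i)) F"
      by (intro tendsto_intros)
    then have "\<forall>\<^sub>F t in F. d $ i * h i (x t $ i) < d $ i * h i (xs $ i) + 1"
      by (rule order_tendstoD) simp
    then have "\<forall>\<^sub>F t in F. d $ i * h i (x t $ i) \<le> d $ i * h i (xs $ i) + 1"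
      by (rule eventually_mono) simp
    then show ?thesis ..
  qed
  then obtain B where B: "\<And>i. \<forall>\<^sub>F t in F. d $ i * h i (x t $ i) \<le> B i"
    by metis
  have "\<forall>\<^sub>F t in F. \<forall>i. d $ i * h i (x t $ i) \<le> B i"
    using B by (rule eventually_all_finite)
  then have "\<forall>\<^sub>F t in F. (\<Sum>i\<in>UNIV. d $ i * h i (x t $ i)) \<le> (\<Sum>i\<in>UNIV. B i)"
    by eventually_elim (intro sum_mono, simp)
  then show thesis by (rule that)
qed

text \<open>The representation is only assumed on the orthant; this suffices because the orthant is open.\<close>

lemma partial_deriv_separable:
  fixes g :: "real ^ 'n \<Rightarrow> real"
  assumes g: "\<And>y. y \<in> pos_orthant \<Longrightarrow> g y = (\<Sum>i\<in>UNIV. h i (y $ i))"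
    and x: "x \<in> pos_orthant"
    and h: "\<And>i. (h i has_real_derivative D i) (at (x $ i))"
  shows "partial_deriv j g x = D j"
proof -
  have "((\<lambda>t. x + t *\<^sub>R axis j 1) \<longlongrightarrow> x + 0 *\<^sub>R axis j 1) (nhds (0::real))"
    by (intro tendsto_intros filterlim_ident)
  then have ev: "\<forall>\<^sub>F t in nhds (0::real). x + t *\<^sub>R axis j 1 \<in> pos_orthant"
    using x open_pos_orthant by (auto intro: topological_tendstoD)
  have "((\<lambda>t. h i (x $ i + t * axis j 1 $ i)) has_real_derivative D i * axis j 1 $ i) (at 0)" for i
    by (rule DERIV_chain2[where f = "h i"]) (use h[of i] in \<open>auto intro!: derivative_eq_intros\<close>)
  then have "((\<lambda>t. \<Sum>i\<in>UNIV. h i (x $ i + t * axis j 1 $ i)) has_real_derivative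
      (\<Sum>i\<in>UNIV. D i * axis j 1 $ i)) (at 0)"
    by (intro DERIV_sum)
  moreover have "(\<Sum>i\<in>UNIV. D i * axis j 1 $ i) = D j"
    by (simp add: axis_def if_distrib cong: if_cong)
  moreover have "\<forall>\<^sub>F t in nhds 0. g (x + t *\<^sub>R axis j 1) = (\<Sum>i\<in>UNIV. h i (x $ i + t * axis j 1 $ i))"
    using ev by eventually_elim (simp add: g)
  ultimately have "((\<lambda>t. g (x + t *\<^sub>R axis j 1)) has_real_derivative D j) (at 0)"
    by (subst DERIV_cong_ev) (auto simp: refl)
  then show ?thesis
    unfolding partial_deriv_def by (rule DERIV_imp_deriv)
qed

text \<open>Two applications of the previous lemma, the second one to the partial derivative \<open>\<partial>\<^sub>j\<phi>\<close>, which is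
  again separable, with only its \<open>j\<close>-th summand nonzero.\<close>

lemma hessian_separable:
  fixes \<phi> :: "real ^ 'n \<Rightarrow> real"
  assumes \<phi>: "\<And>y. y \<in> pos_orthant \<Longrightarrow> \<phi> y = (\<Sum>i\<in>UNIV. q i (y $ i))"
    and q: "\<And>i t. t > 0 \<Longrightarrow> (q i has_real_derivative q' i t) (at t)"
    and q': "\<And>i t. t > 0 \<Longrightarrow> (q' i has_real_derivative q'' i t) (at t)"
    and x: "x \<in> pos_orthant"
  shows "hessian \<phi> x = (\<chi> i j. if i = j then q'' i (x $ i) else 0)"
proof -
  have grad: "partial_deriv j \<phi> y = (\<Sum>i\<in>UNIV. if i = j then q' i (y $ i) else 0)"
    if "y \<in> pos_orthant" for y j
  proof -
    have "partial_deriv j \<phi> y = q' j (y $ j)"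
      by (rule partial_deriv_separable[where h = q and D = "\<lambda>i. q' i (y $ i)"])
        (use \<phi> q that in \<open>auto simp: pos_orthant_def\<close>)
    then show ?thesis by simp
  qed
  have "partial_deriv i (partial_deriv j \<phi>) x = (if i = j then q'' i (x $ i) else 0)" for i j
  proof (rule partial_deriv_separable[where g = "partial_deriv j \<phi>" and h = "\<lambda>i t. if i = j then q' i t else 0"
        and D = "\<lambda>i. if i = j then q'' i (x $ i) else 0", OF grad x])
    show "((\<lambda>t. if i = j then q' i t else 0) has_real_derivative (if i = j then q'' i (x $ i) else 0))
        (at (x $ i))" for i
      using q'[of "x $ i" i] x by (auto simp: pos_orthant_def)
  qed
  then show ?thesis
    by (simp add: hessian_def vec_eq_iff)
qed

text \<open>Multiplying by the Hessian \<open>H\<close> turns \<open>P H\<inverse> v\<close> into \<open>v - A\<^sup>T y\<close> for some \<open>y\<close>, and \<open>A\<^sup>T y\<close> is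
  orthogonal to the null space of \<open>A\<close>.\<close>

lemma inner_hessian_hess_proj:
  fixes A :: "real ^ 'n ^ 'm"
  assumes "invertible (hessian \<phi> x)" and "A *v d = 0"
  shows "d \<bullet> (hessian \<phi> x *v (hess_proj A \<phi> x *v (matrix_inv (hessian \<phi> x) *v v))) = d \<bullet> v"
proof -
  let ?H = "hessian \<phi> x"
  have inv: "?H *v (matrix_inv ?H *v w) = w" for w
  proof -
    have "?H ** matrix_inv ?H = mat 1"
      using someI_ex[OF assms(1)[unfolded invertible_def]] by (simp add: matrix_inv_def)
    then show ?thesis
      by (simp add: matrix_vector_mul_assoc)
  qed
  define y where "y = matrix_inv (A ** matrix_inv ?H ** transpose A) *v (A *v (matrix_inv ?H *v v))"
  have "hess_proj A \<phi> x *v (matrix_inv ?H *v v) = matrix_inv ?H *v v - matrix_inv ?H *v (transpose A *v y)"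
    by (simp add: hess_proj_def y_def matrix_vector_mult_diff_rdistrib matrix_vector_mul_assoc [symmetric])
  then have "?H *v (hess_proj A \<phi> x *v (matrix_inv ?H *v v)) = v - transpose A *v y"
    by (simp add: matrix_vector_mult_diff_distrib inv)
  then show ?thesis
    using assms(2) by (simp add: inner_diff_right inner_transpose_matrix_vector del: transpose_matrix_vector)
qed

text \<open>In the mirror variable \<open>\<nabla>\<phi>(x(t))\<close> the flow reads \<open>d/dt \<nabla>\<phi>(x(t)) = - v + A\<^sup>T y\<close> for some \<open>y\<close>,
  and the multiplier \<open>y\<close> disappears against directions \<open>d\<close> with \<open>A d = 0\<close>.\<close>

lemma has_derivative_kernel_pairing:
  fixes A :: "real ^ 'n ^ 'm" and x :: "real \<Rightarrow> real ^ 'n"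
  assumes \<phi>: "\<And>y. y \<in> pos_orthant \<Longrightarrow> \<phi> y = (\<Sum>i\<in>UNIV. q i (y $ i))"
    and q: "\<And>i s. s > 0 \<Longrightarrow> (q i has_real_derivative q' i s) (at s)"
    and q': "\<And>i s. s > 0 \<Longrightarrow> (q' i has_real_derivative q'' i s) (at s)"
    and q''_pos: "\<And>i s. s > 0 \<Longrightarrow> q'' i s > 0"
    and pos: "x t \<in> pos_orthant"
    and d: "A *v d = 0"
    and x': "(x has_vector_derivative
        - (hess_proj A \<phi> (x t) *v (matrix_inv (hessian \<phi> (x t)) *v v))) (at t)"
  shows "((\<lambda>t. \<Sum>i\<in>UNIV. d $ i * q' i (x t $ i)) has_real_derivative - (v \<bullet> d)) (at t)"
proof -
  let ?H = "hessian \<phi> (x t)"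
  define z where "z = - (hess_proj A \<phi> (x t) *v (matrix_inv ?H *v v))"
  have H: "?H = (\<chi> i j. if i = j then q'' i (x t $ i) else 0)"
    using hessian_separable[OF \<phi> q q' pos] .
  have Hz: "(?H *v w) $ i = q'' i (x t $ i) * w $ i" for w i
    by (simp add: H matrix_vector_mult_def if_distrib if_distribR cong: if_cong)
  have "invertible ?H"
    unfolding invertible_left_inverse matrix_left_invertible_ker
  proof (intro allI impI)
    fix w assume "?H *v w = 0"
    then have "q'' i (x t $ i) * w $ i = 0" for i
      using Hz[of w i] by simp
    moreover have "q'' i (x t $ i) \<noteq> 0" for i
      using q''_pos[of "x t $ i" i] pos by (simp add: pos_orthant_def)
    ultimately show "w = 0"
      by (simp add: vec_eq_iff)
  qed
  have "((\<lambda>t. x t $ i) has_real_derivative z $ i) (at t)" for i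
    using bounded_linear.has_vector_derivative[OF bounded_linear_vec_nth x', of i]
    by (simp add: z_def has_real_derivative_iff_has_vector_derivative)
  then have "((\<lambda>t. q' i (x t $ i)) has_real_derivative q'' i (x t $ i) * z $ i) (at t)" for i
    using q' pos by (intro DERIV_chain2[where f = "q' i"]) (auto simp: pos_orthant_def)
  then have "((\<lambda>t. \<Sum>i\<in>UNIV. d $ i * q' i (x t $ i)) has_real_derivative
      (\<Sum>i\<in>UNIV. d $ i * (q'' i (x t $ i) * z $ i))) (at t)"
    by (intro DERIV_sum DERIV_cmult)
  moreover have "(\<Sum>i\<in>UNIV. d $ i * (q'' i (x t $ i) * z $ i)) = d \<bullet> (?H *v z)"
    by (simp add: inner_vec_def Hz)
  moreover have "\<dots> = - (d \<bullet> (?H *v (hess_proj A \<phi> (x t) *v (matrix_inv ?H *v v))))"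
    using matrix_vector_mult_diff_distrib[of ?H 0] by (simp add: z_def flip: inner_minus_right)
  moreover have "\<dots> = - (v \<bullet> d)"
    using inner_hessian_hess_proj[OF \<open>invertible ?H\<close> d] by (simp add: inner_commute)
  ultimately show ?thesis by simp
qed


section \<open>Limits of trajectories are stationary\<close>

theorem proposition3p8:
  fixes f :: "real ^ 'n \<Rightarrow> real"
    and A :: "real ^ 'n ^ 'm"
    and b :: "real ^ 'm"
    and \<phi> :: "real ^ 'n \<Rightarrow> real"
    and x :: "real \<Rightarrow> real ^ 'n"
    and xstar :: "real ^ 'n"
  assumes "locally_lipschitz f"
    and "path_differentiable f"
    and "rank A = CARD('m)"
    and "separable_kernel \<phi>"
    and "\<exists>G. continuous_on (affine_constraint A b \<inter> closure pos_orthant) G \<and>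
           (\<forall>y\<in>affine_constraint A b \<inter> pos_orthant.
              G y = hess_proj A \<phi> y ** matrix_inv (hessian \<phi> y))"
    and "trajectory A b \<phi> f x"
    and "(x \<longlongrightarrow> xstar) at_top"
  shows "xstar \<in> stationary_set A b f"
proof (rule ccontr)
  assume nonstationary: "xstar \<notin> stationary_set A b f"
  obtain q q' q'' :: "'n \<Rightarrow> real \<Rightarrow> real"
    where \<phi>: "\<And>y. y \<in> pos_orthant \<Longrightarrow> \<phi> y = (\<Sum>i\<in>UNIV. q i (y $ i))"
    and q: "\<And>i s. s > 0 \<Longrightarrow> (q i has_real_derivative q' i s) (at s)"
    and q': "\<And>i s. s > 0 \<Longrightarrow> (q' i has_real_derivative q'' i s) (at s)"
    and q''_pos: "\<And>i s. s > 0 \<Longrightarrow> q'' i s > 0"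
    and q''_cont: "\<And>i. continuous_on {0<..} (q'' i)"
    by (rule separable_kernel_derivatives[OF assms(4)]) (rule that)
  have ac: "abs_continuous_curve x"
    and feasible: "\<And>t. t \<ge> 0 \<Longrightarrow> x t \<in> affine_constraint A b \<inter> pos_orthant"
    and flow: "AE t in lborel. t > 0 \<longrightarrow> (\<exists>v\<in>clarke_subdiff f (x t). (x has_vector_derivative
        - (hess_proj A \<phi> (x t) *v (matrix_inv (hessian \<phi> (x t)) *v v))) (at t))"
    using assms(6) unfolding trajectory_def by auto
  have ev0: "\<forall>\<^sub>F t in at_top. 0 \<le> (t::real)"
    by (rule eventually_ge_at_top)
  have xs_closure: "xstar \<in> closure pos_orthant"
  proof (rule Lim_in_closed_set[OF closed_closure _ _ assms(7)])
    show "\<forall>\<^sub>F t in at_top. x t \<in> closure pos_orthant"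
      using ev0 by eventually_elim (use feasible closure_subset in blast)
  qed simp
  have "((\<lambda>t. A *v x t) \<longlongrightarrow> A *v xstar) at_top"
    by (rule bounded_linear.tendsto[OF matrix_vector_mul_bounded_linear assms(7)])
  moreover have "\<forall>\<^sub>F t in at_top. A *v x t = b"
    using ev0 by eventually_elim (use feasible in \<open>auto simp: affine_constraint_def\<close>)
  then have "((\<lambda>t. A *v x t) \<longlongrightarrow> b) at_top"
    by (rule tendsto_eventually)
  ultimately have "A *v xstar = b"
    by (rule tendsto_unique[rotated]) simp
  have disj: "- v \<notin> range (\<lambda>y. transpose A *v y) + normal_cone (closure pos_orthant) xstar"
    if "v \<in> clarke_subdiff f xstar" for v
  proof
    assume "- v \<in> range (\<lambda>y. transpose A *v y) + normal_cone (closure pos_orthant) xstar"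
    from set_plus_intro[OF that this]
    have "0 \<in> clarke_subdiff f xstar + range (\<lambda>y. transpose A *v y) + normal_cone (closure pos_orthant) xstar"
      by (simp add: add.assoc)
    then show False
      using nonstationary xs_closure \<open>A *v xstar = b\<close>
      by (simp add: stationary_set_def affine_constraint_def)
  qed
  obtain d c where d: "A *v d = 0" "\<And>i. xstar $ i = 0 \<Longrightarrow> 0 \<le> d $ i"
    and "c > 0" and c: "\<And>v. v \<in> clarke_subdiff f xstar \<Longrightarrow> v \<bullet> d < - c"
    by (rule separating_feasible_direction[OF compact_clarke_subdiff[OF assms(1)] convex_clarke_subdiff
        xs_closure]) (erule disj, rule that)
  \<comment> \<open>\<open>g\<close> is \<open>t \<mapsto> \<langle>\<nabla>\<phi>(x(t)), d\<rangle>\<close>, the quantity that must both grow linearly and stay bounded.\<close>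
  define g where "g t = (\<Sum>i\<in>UNIV. d $ i * q' i (x t $ i))" for t
  have "\<forall>\<^sub>F t in at_top. \<forall>v\<in>clarke_subdiff f (x t). v \<bullet> d < - c"
    by (rule eventually_compose_filterlim[OF clarke_subdiff_upper_semicontinuous[OF assms(1) c] assms(7)])
  then obtain T0 where T0: "\<And>t v. t \<ge> T0 \<Longrightarrow> v \<in> clarke_subdiff f (x t) \<Longrightarrow> v \<bullet> d < - c"
    unfolding eventually_at_top_linorder by blast
  obtain N where N: "\<And>t. t \<in> space lborel - N \<Longrightarrow> t > 0 \<longrightarrow> (\<exists>v\<in>clarke_subdiff f (x t).
      (x has_vector_derivative
        - (hess_proj A \<phi> (x t) *v (matrix_inv (hessian \<phi> (x t)) *v v))) (at t))"
    and "N \<in> null_sets lborel"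
    by (rule AE_E3[OF flow]) (rule that)
  \<comment> \<open>The flow equation is only prescribed for \<open>t > 0\<close>, so the comparison starts no earlier than time 1.\<close>
  define T1 where "T1 = max T0 1"
  have "T0 \<le> T1" "1 \<le> T1"
    by (auto simp: T1_def)
  have growth: "c * (T - T1) \<le> g T - g T1" if "T1 \<le> T" for T
  proof (rule abs_continuous_on_increment_ge[OF that])
    have "abs_continuous_on {0..T} x"
      using ac that \<open>1 \<le> T1\<close> by (simp add: abs_continuous_curve_def)
    then have "abs_continuous_on {T1..T} x"
      by (rule abs_continuous_on_subset) (use \<open>1 \<le> T1\<close> in auto)
    then show "abs_continuous_on {T1..T} g"
      unfolding g_def
    proof (rule abs_continuous_on_separable_comp)
      show "x t \<in> pos_orthant" if "t \<in> {T1..T}" for t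
        using feasible[of t] that \<open>1 \<le> T1\<close> by simp
    qed (use q' q''_cont in auto)
    show "N \<in> null_sets lebesgue"
      using \<open>N \<in> null_sets lborel\<close> by (rule null_sets_completionI)
    show "\<exists>D\<ge>c. (g has_real_derivative D) (at t within {T1..T})" if t: "t \<in> {T1..T} - N" for t
    proof -
      have "t \<ge> T0" "t > 0" "x t \<in> pos_orthant"
        using t feasible[of t] \<open>T0 \<le> T1\<close> \<open>1 \<le> T1\<close> by auto
      then obtain v where v: "v \<in> clarke_subdiff f (x t)" "(x has_vector_derivative
          - (hess_proj A \<phi> (x t) *v (matrix_inv (hessian \<phi> (x t)) *v v))) (at t)"
        using N[of t] t by auto
      have "(g has_real_derivative - (v \<bullet> d)) (at t)"
        unfolding g_def
        by (rule has_derivative_kernel_pairing[OF \<phi> q q' q''_pos \<open>x t \<in> pos_orthant\<close> d(1) v(2)])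
      moreover have "c \<le> - (v \<bullet> d)"
        using T0[OF \<open>t \<ge> T0\<close> v(1)] by simp
      ultimately show ?thesis
        by (blast intro: has_field_derivative_at_within)
    qed
  qed
  have "\<forall>\<^sub>F t in at_top. x t \<in> pos_orthant"
    using ev0 by eventually_elim (use feasible in blast)
  then obtain B where B: "\<forall>\<^sub>F t in at_top. g t \<le> B"
    unfolding g_def
    by (rule eventually_kernel_pairing_bounded[where h = q' and h' = q'' and d = d,
          OF assms(7) _ q' q''_pos xs_closure d(2)])
  have "\<forall>\<^sub>F T in at_top. (B - g T1) / c + T1 < T"
    by (rule eventually_gt_at_top)
  then have "\<forall>\<^sub>F T in at_top. B - g T1 < c * (T - T1)"
    by eventually_elim (use \<open>c > 0\<close> in \<open>simp add: field_simps\<close>)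
  with B eventually_ge_at_top[of T1]
  have "\<forall>\<^sub>F T in at_top. g T \<le> B \<and> T1 \<le> T \<and> B - g T1 < c * (T - T1)"
    by eventually_elim simp
  then obtain T where "g T \<le> B" "T1 \<le> T" "B - g T1 < c * (T - T1)"
    using eventually_happens'[OF trivial_limit_at_top_linorder] by blast
  with growth[of T] show False by simp
qed

end
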